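(* Let $W$ and $\widetilde W$ be weight matrices of size $N$ supported on the same interval. Suppose there exists a degree-preserving differential operator $\mathcal V\in \operatorname{Mat}_N(\Omega[x])$ such that, with $\mathcal N=\widetilde W\mathcal V^{\ast}W^{-1}$, the operator $D=\mathcal V\mathcal N$ belongs to $\mathcal D(W)$ and $$\langle P\cdot\mathcal V,Q\rangle_{\widetilde W}=\langle P,Q\cdot\mathcal N\rangle_W\qquad\text{for all }P,Q\in\operatorname{Mat}_N(\mathbb C[x]).$$ Then $\widetilde W$ is a Darboux transformation of $W$.
   Context: A weight matrix of size $N$ on an interval $(x_0,x_1)\subseteq\mathbb R$ is a smooth function $W:(x_0,x_1)\to\operatorname{Mat}_N(\mathbb C)$ that is positive definite almost everywhere and has finite moments of all orders. Standing assumption on all weight matrices: for each $n\ge 0$ the derivative $W^{(n)}(x)$ decreases exponentially at infinity and there is a (nonzero) scalar polynomial $p_n$ such that $W^{(n)}p_n$ has finite moments. Put $\langle P,Q\rangle_W=\int_{x_0}^{x_1}P(x)W(x)Q(x)^*\,dx$ for $P,Q\in\operatorname{Mat}_N(\mathbb C[x])$. The monic orthogonal polynomials of $W$ are the unique $P_n\in\operatorname{Mat}_N(\mathbb C[x])$, $n\ge0$, of degree $n$ with leading coefficient $I$ and $\langle P_n,P_m\rangle_W=0$ for $n\ne m$. Differential operators $D=\sum_{i=0}^s\partial^iF_i(x)$, $\partial=d/dx$, act on the right on matrix functions: $P\cdot D=\sum_i P^{(i)}F_i$, and products satisfy $P\cdot(D_1D_2)=(P\cdot D_1)\cdot D_2$.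 $\operatorname{Mat}_N(\Omega[x])$ is the algebra of such operators with coefficients $F_i\in\operatorname{Mat}_N(\mathbb C[x])$. $$\mathcal D(W)=\{D\in\operatorname{Mat}_N(\Omega[x]): P_n\cdot D=\Lambda_n(D)P_n\text{ for some }\Lambda_n(D)\in\operatorname{Mat}_N(\mathbb C),\ \forall n\ge0\}.$$ The formal adjoint ${}^*$ is the involution (reversing products) extending the Hermitian conjugate on matrix functions and sending $\partial I$ to $-\partial I$; thus for $\mathcal V=\sum_j\partial^jF_j$ and $\mathcal N=\widetilde W\mathcal V^*W^{-1}$ one has $Q\cdot\mathcal N=\sum_j(-1)^j(Q\widetilde WF_j^* )^{(j)}W^{-1}$. An operator $\mathcal V\in\operatorname{Mat}_N(\Omega[x])$ is degree-preserving if $\deg(P\cdot\mathcal V)=\deg P$ for all $P\in\operatorname{Mat}_N(\mathbb C[x])$. Darboux transformation: for weight matrices $W,\widetilde W$ on the same interval with monic orthogonal polynomials $P_n,\widetilde P_n$, $\widetilde W$ is a Darboux transformation of $W$ if there exists $D\in\mathcal D(W)$ that can be factorized as $D=\mathcal V\mathcal N$ with degree-preserving operators $\mathcal V,\mathcal N\in\operatorname{Mat}_N(\Omega[x])$ such that $P_n\cdot\mathcal V=A_n\widetilde P_n$ for all $n$, for some matrices $A_n\in\operatorname{Mat}_N(\mathbb C)$. *)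

theory Defs
  imports
    "HOL-Analysis.Analysis"
    "HOL-Computational_Algebra.Polynomial"
    "HOL-Library.Function_Algebras"
begin

text \<open>
  The size of the matrices is the cardinality of the index type. The product of
  matrices is \<open>**\<close>; the componentwise product \<open>*\<close> on vectors is never used.
\<close>

type_synonym 'n cmat = "complex ^ 'n ^ 'n"
type_synonym 'n pmat = "complex poly ^ 'n ^ 'n"

definition hconj :: "'n::finite cmat \<Rightarrow> 'n cmat" where
  "hconj A = (\<chi> i j. cnj (A $ j $ i))"

definition pos_def :: "'n::finite cmat \<Rightarrow> bool" where
  "pos_def A \<longleftrightarrow> hconj A = A \<and> (\<forall>v. v \<noteq> 0 \<longrightarrow> 0 < Re (\<Sum>i\<in>UNIV. cnj (v $ i) * (A *v v) $ i))"

definition nderiv :: "nat \<Rightarrow> (real \<Rightarrow> 'n::finite cmat) \<Rightarrow> real \<Rightarrow> 'n cmat" where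
  "nderiv k = (\<lambda>F x. vector_derivative F (at x)) ^^ k"

text \<open>Only used for open \<open>S\<close>, where the two-sided derivatives are local to \<open>S\<close>.\<close>

definition smooth_on :: "real set \<Rightarrow> (real \<Rightarrow> 'n::finite cmat) \<Rightarrow> bool" where
  "smooth_on S F \<longleftrightarrow> (\<forall>k. \<forall>x\<in>S. nderiv k F differentiable (at x))"

definition pm_const :: "'n::finite cmat \<Rightarrow> 'n pmat" where
  "pm_const A = (\<chi> i j. [:A $ i $ j:])"

definition pm_eval :: "'n::finite pmat \<Rightarrow> real \<Rightarrow> 'n cmat" where
  "pm_eval P x = (\<chi> i j. poly (P $ i $ j) (complex_of_real x))"

definition pm_coeff :: "'n::finite pmat \<Rightarrow> nat \<Rightarrow> 'n cmat" where
  "pm_coeff P k = (\<chi> i j. coeff (P $ i $ j) k)"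

definition pm_deriv :: "'n::finite pmat \<Rightarrow> 'n pmat" where
  "pm_deriv P = (\<chi> i j. pderiv (P $ i $ j))"

text \<open>
  With degree minus infinity for the zero polynomial, a degree-preserving operator
  annihilates no nonzero constant.
\<close>

definition pm_degree :: "'n::finite pmat \<Rightarrow> ereal" where
  "pm_degree P = (if P = 0 then - \<infinity> else ereal (real (Max {degree (P $ i $ j) |i j. True})))"

text \<open>
  An operator \<open>\<Sum>\<^sub>i \<partial>\<^sup>i F\<^sub>i\<close> is stored as its list of coefficients, through the
  type of polynomials in \<open>\<partial>\<close> with coefficients written on the right. Only the
  additive structure of that type is used; the product of operators is \<open>fop_mult\<close>.
  In \<open>dop\<close> the coefficients are matrix polynomials, in \<open>fop\<close> arbitrary matrix functions.
\<close>

type_synonym 'n dop = "'n pmat poly"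
type_synonym 'n fop = "(real \<Rightarrow> 'n cmat) poly"

definition dop_act :: "'n::finite pmat \<Rightarrow> 'n dop \<Rightarrow> 'n pmat" where
  "dop_act P D = (\<Sum>i\<le>degree D. (pm_deriv ^^ i) P ** coeff D i)"

definition fop_act :: "(real \<Rightarrow> 'n::finite cmat) \<Rightarrow> 'n fop \<Rightarrow> real \<Rightarrow> 'n cmat" where
  "fop_act Q D = (\<lambda>x. \<Sum>i\<le>degree D. nderiv i Q x ** coeff D i x)"

definition fop_of_dop :: "'n::finite dop \<Rightarrow> 'n fop" where
  "fop_of_dop D = map_poly pm_eval D"

text \<open>
  Leibniz rule: \<open>P \<cdot> (\<partial>\<^sup>iF \<partial>\<^sup>jG) = (P\<^sup>(\<^sup>i\<^sup>) F)\<^sup>(\<^sup>j\<^sup>) G = \<Sum>\<^sub>k (j choose k) P\<^sup>(\<^sup>i\<^sup>+\<^sup>k\<^sup>) F\<^sup>(\<^sup>j\<^sup>-\<^sup>k\<^sup>) G\<close>, so that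
  \<open>fop_mult C D\<close> is the operator that acts by \<open>C\<close> first and then by \<open>D\<close>.
\<close>

definition fop_mult :: "'n::finite fop \<Rightarrow> 'n fop \<Rightarrow> 'n fop" where
  "fop_mult C D = (\<Sum>i\<le>degree C. \<Sum>j\<le>degree D. \<Sum>k\<le>j.
     monom (\<lambda>x. real (j choose k) *\<^sub>R (nderiv (j - k) (coeff C i) x ** coeff D j x)) (i + k))"

definition fop_fun :: "(real \<Rightarrow> 'n::finite cmat) \<Rightarrow> 'n fop" where
  "fop_fun F = monom F 0"

text \<open>\<open>(\<partial>\<^sup>jF)\<^sup>* = F\<^sup>* (- \<partial>)\<^sup>j\<close>.\<close>

definition fop_adjoint :: "'n::finite fop \<Rightarrow> 'n fop" where
  "fop_adjoint D = (\<Sum>j\<le>degree D.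
     fop_mult (fop_fun (\<lambda>x. hconj (coeff D j x))) (monom (\<lambda>x. mat ((- 1) ^ j)) j))"

definition fop_eq_on :: "real set \<Rightarrow> 'n::finite fop \<Rightarrow> 'n fop \<Rightarrow> bool" where
  "fop_eq_on S C D \<longleftrightarrow> (\<forall>i. \<forall>x\<in>S. coeff C i x = coeff D i x)"

definition degree_preserving :: "'n::finite dop \<Rightarrow> bool" where
  "degree_preserving D \<longleftrightarrow> (\<forall>P. pm_degree (dop_act P D) = pm_degree P)"

definition finite_moments :: "real set \<Rightarrow> (real \<Rightarrow> 'n::finite cmat) \<Rightarrow> bool" where
  "finite_moments S F \<longleftrightarrow> (\<forall>m. set_integrable lebesgue S (\<lambda>x. x ^ m *\<^sub>R F x))"

text \<open>Vacuous for bounded \<open>S\<close>.\<close>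

definition exp_decay_at_infinity :: "real set \<Rightarrow> (real \<Rightarrow> 'n::finite cmat) \<Rightarrow> bool" where
  "exp_decay_at_infinity S F \<longleftrightarrow>
     (\<exists>c>0. \<exists>B R. \<forall>x\<in>S. R \<le> \<bar>x\<bar> \<longrightarrow> norm (F x) \<le> B * exp (- c * \<bar>x\<bar>))"

definition weight_matrix :: "ereal \<Rightarrow> ereal \<Rightarrow> (real \<Rightarrow> 'n::finite cmat) \<Rightarrow> bool" where
  "weight_matrix a b W \<longleftrightarrow>
     a < b \<and>
     smooth_on (einterval a b) W \<and>
     (AE x in lebesgue. x \<in> einterval a b \<longrightarrow> pos_def (W x)) \<and>
     finite_moments (einterval a b) W \<and>
     (\<forall>n. exp_decay_at_infinity (einterval a b) (nderiv n W)) \<and>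
     (\<forall>n. \<exists>p :: complex poly. p \<noteq> 0 \<and>
        finite_moments (einterval a b) (\<lambda>x. mat (poly p (complex_of_real x)) ** nderiv n W x))"

definition inner_W ::
  "ereal \<Rightarrow> ereal \<Rightarrow> (real \<Rightarrow> 'n::finite cmat) \<Rightarrow> (real \<Rightarrow> 'n cmat) \<Rightarrow> (real \<Rightarrow> 'n cmat) \<Rightarrow> 'n cmat" where
  "inner_W a b W P Q = (LINT x:einterval a b|lebesgue. P x ** W x ** hconj (Q x))"

definition monic_orthogonal ::
  "ereal \<Rightarrow> ereal \<Rightarrow> (real \<Rightarrow> 'n::finite cmat) \<Rightarrow> (nat \<Rightarrow> 'n pmat) \<Rightarrow> bool" where
  "monic_orthogonal a b W P \<longleftrightarrow>
     (\<forall>n. pm_degree (P n) = ereal (real n) \<and> pm_coeff (P n) n = mat 1) \<and>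
     (\<forall>n m. n \<noteq> m \<longrightarrow> inner_W a b W (pm_eval (P n)) (pm_eval (P m)) = 0)"

definition monic_ops :: "ereal \<Rightarrow> ereal \<Rightarrow> (real \<Rightarrow> 'n::finite cmat) \<Rightarrow> nat \<Rightarrow> 'n pmat" where
  "monic_ops a b W = (THE P. monic_orthogonal a b W P)"

definition D_algebra :: "ereal \<Rightarrow> ereal \<Rightarrow> (real \<Rightarrow> 'n::finite cmat) \<Rightarrow> 'n dop set" where
  "D_algebra a b W =
     {D. \<forall>n. \<exists>\<Lambda>. dop_act (monic_ops a b W n) D = pm_const \<Lambda> ** monic_ops a b W n}"

definition darboux_transformation ::
  "ereal \<Rightarrow> ereal \<Rightarrow> (real \<Rightarrow> 'n::finite cmat) \<Rightarrow> (real \<Rightarrow> 'n cmat) \<Rightarrow> bool" where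
  "darboux_transformation a b W W' \<longleftrightarrow>
     weight_matrix a b W \<and> weight_matrix a b W' \<and>
     (\<exists>D\<in>D_algebra a b W. \<exists>V N.
        degree_preserving V \<and> degree_preserving N \<and>
        fop_of_dop D = fop_mult (fop_of_dop V) (fop_of_dop N) \<and>
        (\<forall>n. \<exists>A. dop_act (monic_ops a b W n) V = pm_const A ** monic_ops a b W' n))"

text \<open>
  The operator \<open>W' V\<^sup>* W\<^sup>-\<^sup>1\<close>. Its coefficients are meaningful at the points of the interval
  where \<open>W\<close> is invertible, hence almost everywhere.
\<close>

definition conjugate_adjoint ::
  "(real \<Rightarrow> 'n::finite cmat) \<Rightarrow> (real \<Rightarrow> 'n cmat) \<Rightarrow> 'n dop \<Rightarrow> 'n fop" where
  "conjugate_adjoint W W' V =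
     fop_mult (fop_mult (fop_fun W') (fop_adjoint (fop_of_dop V))) (fop_fun (\<lambda>x. matrix_inv (W x)))"

end

theory Submission
  imports Defs
begin

text \<open>
  A degree-preserving \<open>V\<close> acts bijectively on matrix polynomials, so every polynomial is some
  \<open>P \<cdot> V\<close>, which \<open>N\<close> maps to the polynomial \<open>P \<cdot> D\<close>; an operator that preserves
  polynomials has polynomial coefficients, hence \<open>N\<close> agrees with some \<open>M\<close> in \<open>Mat\<^sub>N(\<Omega>[x])\<close>
  wherever \<open>W\<close> is invertible, and \<open>D = V M\<close>. If \<open>P \<cdot> D = 0\<close> then
  \<open>\<langle>P \<cdot> V, P \<cdot> V\<rangle> = \<langle>P, P \<cdot> D\<rangle> = 0\<close>, so \<open>P = 0\<close>; an injective member of \<open>\<D>(W)\<close> preserves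
  degrees, and therefore so does \<open>M\<close>. Finally \<open>\<langle>P\<^sub>n \<cdot> V, Q\<rangle> = \<langle>P\<^sub>n, Q \<cdot> M\<rangle> = 0\<close> whenever
  \<open>deg Q < n\<close>, which makes \<open>P\<^sub>n \<cdot> V\<close> a left multiple of the orthogonal polynomial of \<open>W'\<close>.
\<close>

section \<open>Matrix algebra and Hermitian conjugation\<close>

lemma matrix_mult_component:
  "(A ** B) $ i $ j = (\<Sum>k\<in>UNIV. A $ i $ k * B $ k $ j)"
  by (simp add: matrix_matrix_mult_def)

lemma matrix_mult_zero_right [simp]: "A ** (0 :: 'a::semiring_1^'n^'m) = 0"
  by (simp add: vec_eq_iff matrix_mult_component)

lemma matrix_mult_add_right:
  "(A + B) ** C = A ** C + B ** (C :: 'a::semiring_1^'n^'m)"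
  by (simp add: vec_eq_iff matrix_mult_component algebra_simps sum.distrib)

lemma matrix_mult_sum_right:
  "(\<Sum>i\<in>I. A i) ** B = (\<Sum>i\<in>I. A i ** (B :: 'a::semiring_1^'n^'m))"
  by (induction I rule: infinite_finite_induct) (auto simp: matrix_mult_add_right)

lemma matrix_mult_sum_left:
  "A ** (\<Sum>i\<in>I. B i) = (\<Sum>i\<in>I. A ** (B i :: 'a::semiring_1^'n^'m))"
  by (induction I rule: infinite_finite_induct) (auto simp: matrix_add_ldistrib)

lemma matrix_mult_scaleR_left:
  "A ** (c *\<^sub>R B) = c *\<^sub>R (A ** (B :: 'a::real_algebra_1^'n^'m))"
  by (simp add: vec_eq_iff matrix_mult_component scaleR_sum_right)

lemma matrix_mult_scaleR_right:
  "(c *\<^sub>R A) ** B = c *\<^sub>R (A ** (B :: 'a::real_algebra_1^'n^'m))"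
  by (simp add: vec_eq_iff matrix_mult_component scaleR_sum_right)

text \<open>A linear relation among the rows of \<open>A\<close>, repeated as every row of
  \<open>M\<close>, gives \<open>M ** A = 0\<close>. Leading coefficients and Gram matrices are
  shown invertible in this form.\<close>

lemma invertible_if_left_cancel:
  fixes A :: "'a::field^'n^'n"
  assumes "\<And>M. M ** A = 0 \<Longrightarrow> M = (0 :: 'a^'n^'n)"
  shows "invertible A"
proof -
  have "c i = 0" if c: "(\<Sum>i\<in>UNIV. c i *s row i A) = 0" for c i
  proof -
    define M :: "'a^'n^'n" where "M = (\<chi> k. \<chi> i. c i)"
    have "M ** A = 0"
      using c by (simp add: vec_eq_iff matrix_mult_component M_def row_def)
    then have "M = 0" by (rule assms)
    then show ?thesis by (simp add: M_def vec_eq_iff)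
  qed
  then show ?thesis
    unfolding invertible_right_inverse matrix_right_invertible_independent_rows by blast
qed

lemma bounded_linear_matrix_unit:
  "bounded_linear (\<lambda>z. axis i (axis j z) :: complex^'n::finite^'m::finite)"
  by (intro linear_conv_bounded_linear[THEN iffD1] linearI) (auto simp: axis_def vec_eq_iff)

text \<open>Through this decomposition, differentiability and integrability pass from the entries to
  the matrix, each summand being a bounded linear image of one entry.\<close>

lemma matrix_unit_sum:
  "(\<Sum>i\<in>UNIV. \<Sum>j\<in>UNIV. axis i (axis j (A $ i $ j))) = (A :: 'a::comm_monoid_add^'n::finite^'m::finite)"
proof -
  have "(\<Sum>k\<in>UNIV. \<Sum>l\<in>UNIV. axis k (axis l (A $ k $ l)) $ i $ j) = A $ i $ j" for i j
  proof -
    have "(\<Sum>k\<in>UNIV. \<Sum>l\<in>UNIV. axis k (axis l (A $ k $ l)) $ i $ j) =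
        (\<Sum>k\<in>UNIV. if k = i then \<Sum>l\<in>UNIV. if l = j then A $ k $ l else 0 else 0)"
      by (intro sum.cong) (auto simp: axis_def intro!: sum.cong)
    then show ?thesis by simp
  qed
  then show ?thesis by (simp add: vec_eq_iff)
qed

lemma hconj_zero [simp]: "hconj 0 = 0"
  by (simp add: hconj_def vec_eq_iff)

lemma hconj_hconj [simp]: "hconj (hconj A) = A"
  by (simp add: hconj_def vec_eq_iff)

lemma hconj_add: "hconj (A + B) = hconj A + hconj B"
  by (simp add: hconj_def vec_eq_iff)

lemma hconj_mult: "hconj (A ** B) = hconj B ** hconj A"
  by (simp add: hconj_def vec_eq_iff matrix_mult_component mult.commute)

lemma pos_def_invertible:
  assumes "pos_def A"
  shows "invertible A"
proof -
  have "v = 0" if "A *v v = 0" for v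
    using assms that unfolding pos_def_def by (cases "v = 0") fastforce+
  then show ?thesis
    by (simp add: invertible_left_inverse matrix_left_invertible_ker)
qed

section \<open>Matrix polynomials\<close>

lemma pm_eval_zero: "pm_eval 0 = 0"
  by (simp add: fun_eq_iff pm_eval_def vec_eq_iff)

lemma pm_eval_add: "pm_eval (P + Q) x = pm_eval P x + pm_eval Q x"
  by (simp add: pm_eval_def vec_eq_iff)

lemma pm_eval_diff: "pm_eval (P - Q) x = pm_eval P x - pm_eval Q x"
  by (simp add: pm_eval_def vec_eq_iff)

lemma pm_eval_sum: "pm_eval (\<Sum>i\<in>I. P i) x = (\<Sum>i\<in>I. pm_eval (P i) x)"
  by (induction I rule: infinite_finite_induct) (auto simp: pm_eval_add pm_eval_zero)

lemma pm_eval_mult: "pm_eval (P ** Q) x = pm_eval P x ** pm_eval Q x"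
  by (simp add: pm_eval_def vec_eq_iff matrix_mult_component poly_sum)

lemma pm_eval_const [simp]: "pm_eval (pm_const A) x = A"
  by (simp add: pm_eval_def pm_const_def vec_eq_iff)

text \<open>A nonzero entry of \<open>P - Q\<close> would have infinitely many roots. Identities
  known only where \<open>W\<close> is invertible become polynomial identities this way.\<close>

lemma pm_eval_eqI:
  assumes "infinite S" "\<And>x. x \<in> S \<Longrightarrow> pm_eval P x = pm_eval Q x"
  shows "P = Q"
proof -
  have "P $ i $ j = Q $ i $ j" for i j
  proof (rule ccontr)
    assume "P $ i $ j \<noteq> Q $ i $ j"
    then have "finite {z. poly (P $ i $ j - Q $ i $ j) z = 0}"
      by (intro poly_roots_finite) simp
    moreover have "complex_of_real ` S \<subseteq> {z. poly (P $ i $ j - Q $ i $ j) z = 0}"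
      using assms(2) by (auto simp: pm_eval_def vec_eq_iff)
    ultimately have "finite (complex_of_real ` S)"
      using finite_subset by blast
    then show False
      using assms(1) by (simp add: finite_image_iff inj_on_def)
  qed
  then show ?thesis by (simp add: vec_eq_iff)
qed

lemma pm_const_zero [simp]: "pm_const 0 = 0"
  by (simp add: pm_const_def vec_eq_iff)

lemma pm_const_mat_1 [simp]: "pm_const (mat 1) = mat 1"
  by (simp add: pm_const_def mat_def vec_eq_iff one_pCons)

lemma pm_const_mult: "pm_const (A ** B) = pm_const A ** pm_const B"
  by (rule pm_eval_eqI[of UNIV]) (simp_all add: pm_eval_mult infinite_UNIV_char_0)

lemma pm_coeff_zero [simp]: "pm_coeff 0 k = 0"
  by (simp add: pm_coeff_def vec_eq_iff)

lemma pm_coeff_add: "pm_coeff (P + Q) k = pm_coeff P k + pm_coeff Q k"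
  by (simp add: pm_coeff_def vec_eq_iff)

lemma pm_coeff_diff: "pm_coeff (P - Q) k = pm_coeff P k - pm_coeff Q k"
  by (simp add: pm_coeff_def vec_eq_iff)

lemma pm_coeff_const_mult: "pm_coeff (pm_const A ** P) k = A ** pm_coeff P k"
  by (simp add: pm_coeff_def pm_const_def vec_eq_iff matrix_mult_component coeff_sum)

lemma pm_eq_zero_iff: "P = 0 \<longleftrightarrow> (\<forall>k. pm_coeff P k = 0)"
  by (auto simp: pm_coeff_def vec_eq_iff poly_eq_iff)

lemma pm_deriv_zero [simp]: "pm_deriv 0 = 0"
  by (simp add: pm_deriv_def vec_eq_iff)

lemma pm_deriv_add: "pm_deriv (P + Q) = pm_deriv P + pm_deriv Q"
  by (simp add: pm_deriv_def vec_eq_iff pderiv_add)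

lemma pm_deriv_mult: "pm_deriv (P ** Q) = pm_deriv P ** Q + P ** pm_deriv Q"
proof -
  have *: "pderiv (\<Sum>k\<in>I. f k) = (\<Sum>k\<in>I. pderiv (f k))" for I and f :: "'n \<Rightarrow> complex poly"
    by (induction I rule: infinite_finite_induct) (auto simp: pderiv_add)
  show ?thesis
    by (simp add: pm_deriv_def vec_eq_iff matrix_mult_component * pderiv_mult sum.distrib
      mult.commute add.commute)
qed

lemma pm_deriv_const [simp]: "pm_deriv (pm_const A) = 0"
  by (simp add: pm_deriv_def pm_const_def vec_eq_iff pderiv_pCons)

lemma pm_deriv_funpow_zero [simp]: "(pm_deriv ^^ i) 0 = 0"
  by (induction i) auto

lemma pm_deriv_funpow_add: "(pm_deriv ^^ i) (P + Q) = (pm_deriv ^^ i) P + (pm_deriv ^^ i) Q"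
  by (induction i) (auto simp: pm_deriv_add)

lemma pm_deriv_funpow_sum:
  "(pm_deriv ^^ i) (\<Sum>k\<in>I. P k) = (\<Sum>k\<in>I. (pm_deriv ^^ i) (P k))"
  by (induction I rule: infinite_finite_induct) (auto simp: pm_deriv_funpow_add)

lemma pm_deriv_funpow_const_mult:
  "(pm_deriv ^^ i) (pm_const A ** P) = pm_const A ** (pm_deriv ^^ i) P"
  by (induction i) (auto simp: pm_deriv_mult)

lemma has_vector_derivative_pm_eval:
  "(pm_eval P has_vector_derivative pm_eval (pm_deriv P) x) (at x)"
proof -
  have *: "((\<lambda>x. poly p (complex_of_real x)) has_vector_derivative
        poly (pderiv p) (complex_of_real x)) (at x)" for p
    by (rule has_vector_derivative_real_field) (rule poly_DERIV)
  have "((\<lambda>x. \<Sum>i\<in>UNIV. \<Sum>j\<in>UNIV. axis i (axis j (pm_eval P x $ i $ j))) has_vector_derivative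
      (\<Sum>i\<in>UNIV. \<Sum>j\<in>UNIV. axis i (axis j (pm_eval (pm_deriv P) x $ i $ j)))) (at x)"
    by (intro has_vector_derivative_sum bounded_linear.has_vector_derivative[OF bounded_linear_matrix_unit])
       (simp add: pm_eval_def pm_deriv_def *)
  then show ?thesis
    by (simp add: matrix_unit_sum)
qed

text \<open>Analytic and formal derivatives agree on polynomials, so the action of an operator on
  them is a matter of algebra.\<close>

lemma nderiv_pm_eval: "nderiv i (pm_eval P) = pm_eval ((pm_deriv ^^ i) P)"
proof (induction i)
  case (Suc i)
  have "nderiv (Suc i) (pm_eval P) = (\<lambda>x. vector_derivative (nderiv i (pm_eval P)) (at x))"
    by (simp add: nderiv_def)
  also have "\<dots> = pm_eval ((pm_deriv ^^ Suc i) P)"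
    by (simp add: Suc fun_eq_iff vector_derivative_at has_vector_derivative_pm_eval)
  finally show ?case .
qed (simp add: nderiv_def)

text \<open>The Leibniz rule with the factors kept in order, in the evaluated form that matches the
  coefficients of \<open>fop_mult\<close>. One derivative is taken first, and Pascal's rule merges
  the two resulting sums.\<close>

lemma pm_deriv_funpow_mult:
  "pm_eval ((pm_deriv ^^ j) (P ** Q)) x =
     (\<Sum>k\<le>j. real (j choose k) *\<^sub>R
        (pm_eval ((pm_deriv ^^ k) P) x ** pm_eval ((pm_deriv ^^ (j - k)) Q) x))"
proof (induction j arbitrary: P Q)
  case 0
  then show ?case by (simp add: pm_eval_mult)
next
  case (Suc j)
  define f where "f k l = pm_eval ((pm_deriv ^^ k) P) x ** pm_eval ((pm_deriv ^^ l) Q) x" for k l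
  have f: "pm_eval ((pm_deriv ^^ k) P) x ** pm_eval ((pm_deriv ^^ l) Q) x = f k l" for k l
    by (simp add: f_def)
  have "pm_eval ((pm_deriv ^^ Suc j) (P ** Q)) x =
      (\<Sum>k\<le>j. real (j choose k) *\<^sub>R f (Suc k) (j - k)) +
      (\<Sum>k\<le>j. real (j choose k) *\<^sub>R f k (Suc (j - k)))"
    using Suc[of "pm_deriv P" Q] Suc[of P "pm_deriv Q"]
    by (simp only: funpow_Suc_right o_def pm_deriv_mult pm_deriv_funpow_add pm_eval_add f_def)
  \<comment> \<open>The added term \<open>k = Suc j\<close> vanishes because
    \<open>j choose Suc j\<close> is 0.\<close>
  also have "(\<Sum>k\<le>j. real (j choose k) *\<^sub>R f k (Suc (j - k))) =
      (\<Sum>k\<le>Suc j. real (j choose k) *\<^sub>R f k (Suc j - k))"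
    by (simp add: Suc_diff_le)
  also have "\<dots> = f 0 (Suc j) + (\<Sum>k\<le>j. real (j choose Suc k) *\<^sub>R f (Suc k) (j - k))"
    by (subst sum.atMost_Suc_shift) simp
  also have "(\<Sum>k\<le>j. real (j choose k) *\<^sub>R f (Suc k) (j - k)) + \<dots> =
      f 0 (Suc j) + (\<Sum>k\<le>j. real (Suc j choose Suc k) *\<^sub>R f (Suc k) (j - k))"
    by (simp add: sum.distrib algebra_simps)
  also have "\<dots> = (\<Sum>k\<le>Suc j. real (Suc j choose k) *\<^sub>R f k (Suc j - k))"
    by (simp only: sum.atMost_Suc_shift) simp
  finally show ?case by (simp only: f)
qed

section \<open>Degree bounds\<close>

text \<open>Strict bounds are closed under sums and treat the zero polynomial uniformly: it is the
  only one with bound 0, where inductions on the degree start.\<close>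

definition pm_deg_less :: "nat \<Rightarrow> 'n::finite pmat \<Rightarrow> bool" where
  "pm_deg_less n P \<longleftrightarrow> (\<forall>k\<ge>n. pm_coeff P k = 0)"

lemma pm_degree_less_iff: "pm_degree P < ereal (real n) \<longleftrightarrow> pm_deg_less n P"
proof (cases "P = 0")
  case True
  then show ?thesis by (simp add: pm_degree_def pm_deg_less_def)
next
  case False
  have eq: "{degree (P $ i $ j) |i j. True} = (\<lambda>(i, j). degree (P $ i $ j)) ` UNIV"
    by auto
  have "pm_degree P < ereal (real n) \<longleftrightarrow> (\<forall>i j. degree (P $ i $ j) < n)"
    using False unfolding pm_degree_def eq by simp
  also have "\<dots> \<longleftrightarrow> pm_deg_less n P"
  proof
    assume "\<forall>i j. degree (P $ i $ j) < n"
    then show "pm_deg_less n P"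
      by (auto simp: pm_deg_less_def pm_coeff_def vec_eq_iff intro!: coeff_eq_0
          intro: less_le_trans)
  next
    assume *: "pm_deg_less n P"
    \<comment> \<open>Zero entries have \<open>degree\<close> 0, so the strict bound on them
      requires \<open>n\<close> to be positive.\<close>
    have "n > 0"
      using * False by (cases n) (auto simp: pm_deg_less_def pm_eq_zero_iff)
    moreover have "P $ i $ j = 0" if "degree (P $ i $ j) \<ge> n" for i j
      using * that
      by (simp add: pm_deg_less_def pm_coeff_def vec_eq_iff flip: leading_coeff_0_iff)
    ultimately show "\<forall>i j. degree (P $ i $ j) < n"
      by (metis degree_0 not_le)
  qed
  finally show ?thesis .
qed

lemma pm_degree_nonzero: "P \<noteq> 0 \<Longrightarrow> \<exists>n. pm_degree P = ereal (real n)"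
  by (auto simp: pm_degree_def)

text \<open>The values of \<open>pm_degree\<close> are minus infinity and the natural numbers, so
  the natural numbers strictly above the degree determine it.\<close>

lemma pm_degree_eqI:
  fixes P Q :: "'n::finite pmat"
  assumes "\<And>n. pm_deg_less n P \<longleftrightarrow> pm_deg_less n Q"
  shows "pm_degree P = pm_degree Q"
proof -
  have "pm_degree Q \<le> pm_degree P"
    if "\<And>n. pm_deg_less n P \<Longrightarrow> pm_deg_less n Q" for P Q :: "'n pmat"
  proof (cases "Q = 0")
    case False
    then obtain m where m: "pm_degree Q = ereal (real m)"
      using pm_degree_nonzero by blast
    then have "\<not> pm_deg_less m Q"
      by (simp flip: pm_degree_less_iff)
    then have "\<not> pm_degree P < ereal (real m)"
      using that by (auto simp: pm_degree_less_iff)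
    then show ?thesis by (simp add: m)
  qed (simp add: pm_degree_def)
  then show ?thesis
    using assms by (intro antisym) auto
qed

lemma pm_degree_eq_iff:
  "pm_degree P = ereal (real n) \<longleftrightarrow> pm_deg_less (Suc n) P \<and> \<not> pm_deg_less n P"
proof (cases "P = 0")
  case False
  then obtain m where "pm_degree P = ereal (real m)"
    using pm_degree_nonzero by blast
  then show ?thesis
    by (auto simp flip: pm_degree_less_iff)
qed (simp add: pm_degree_def pm_deg_less_def)

lemma pm_deg_less_zero [simp]: "pm_deg_less n 0"
  by (simp add: pm_deg_less_def)

lemma pm_deg_less_0_iff [simp]: "pm_deg_less 0 P \<longleftrightarrow> P = 0"
  by (simp add: pm_deg_less_def pm_eq_zero_iff)

lemma pm_deg_less_add: "pm_deg_less n P \<Longrightarrow> pm_deg_less n Q \<Longrightarrow> pm_deg_less n (P + Q)"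
  by (simp add: pm_deg_less_def pm_coeff_add)

lemma pm_deg_less_diff: "pm_deg_less n P \<Longrightarrow> pm_deg_less n Q \<Longrightarrow> pm_deg_less n (P - Q)"
  by (simp add: pm_deg_less_def pm_coeff_diff)

lemma pm_deg_less_const_mult: "pm_deg_less n P \<Longrightarrow> pm_deg_less n (pm_const A ** P)"
  by (simp add: pm_deg_less_def pm_coeff_const_mult)

lemma pm_deg_less_mono: "pm_deg_less n P \<Longrightarrow> n \<le> m \<Longrightarrow> pm_deg_less m P"
  by (simp add: pm_deg_less_def)

lemma pm_deg_less_SucI: "pm_deg_less (Suc n) P \<Longrightarrow> pm_coeff P n = 0 \<Longrightarrow> pm_deg_less n P"
  unfolding pm_deg_less_def by (metis le_antisym not_less_eq_eq)

lemma pm_deg_less_exists: "\<exists>n. pm_deg_less n P"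
proof (cases "P = 0")
  case False
  then obtain m where "pm_degree P = ereal (real m)"
    using pm_degree_nonzero by blast
  then show ?thesis using pm_degree_eq_iff by blast
qed simp

text \<open>
  The divided powers \<open>x\<^sup>k/k!\<close> are lowered by differentiation, so the equations obtained by letting
  an operator act on them are triangular with unit diagonal in its coefficients.
\<close>

definition pm_dpow :: "nat \<Rightarrow> 'n::finite pmat" where
  "pm_dpow k = (\<chi> i j. if i = j then monom (1 / fact k) k else 0)"

lemma pm_dpow_0: "pm_eval (pm_dpow 0) x = mat 1"
  by (simp add: pm_dpow_def pm_eval_def mat_def vec_eq_iff poly_monom)

lemma pm_deriv_dpow: "pm_deriv (pm_dpow k) = (if k = 0 then 0 else pm_dpow (k - 1))"
  by (cases k) (auto simp: pm_dpow_def pm_deriv_def vec_eq_iff pderiv_monom fact_reduce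
      simp flip: of_nat_Suc)

lemma pm_deriv_funpow_dpow:
  "(pm_deriv ^^ i) (pm_dpow k) = (if i \<le> k then pm_dpow (k - i) else 0)"
  by (induction i) (auto simp: pm_deriv_dpow)

lemma pm_coeff_dpow: "pm_coeff (pm_dpow n) k = (if k = n then mat (1 / fact n) else 0)"
  by (auto simp: pm_dpow_def pm_coeff_def vec_eq_iff mat_def)

text \<open>The matrix monomial \<open>x^n\<close> times the identity, as a left multiple of a
  divided power.\<close>

definition pm_monom :: "nat \<Rightarrow> 'n::finite pmat" where
  "pm_monom n = pm_const (mat (fact n)) ** pm_dpow n"

lemma pm_coeff_monom:
  "pm_coeff (pm_monom n :: 'n::finite pmat) k = (if k = n then mat 1 else 0)"
proof -
  have "(\<Sum>k\<in>UNIV. mat (fact n) $ i $ k * mat (1 / fact n) $ k $ j) =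
      (\<Sum>k\<in>UNIV. if k = i then mat 1 $ i $ j else (0 :: complex))" for i j :: 'n
    by (intro sum.cong) (auto simp: mat_def)
  then have "mat (fact n) ** mat (1 / fact n) = (mat 1 :: 'n cmat)"
    by (simp add: vec_eq_iff matrix_mult_component)
  then show ?thesis
    by (simp add: pm_monom_def pm_coeff_const_mult pm_coeff_dpow)
qed

lemma pm_deg_less_monom: "pm_deg_less (Suc n) (pm_monom n)"
  by (simp add: pm_deg_less_def pm_coeff_monom)

section \<open>Differential operators\<close>

lemma dop_act_add: "dop_act (P + Q) D = dop_act P D + dop_act Q D"
  by (simp add: dop_act_def pm_deriv_funpow_add matrix_mult_add_right sum.distrib)

lemma dop_act_const_mult: "dop_act (pm_const A ** P) D = pm_const A ** dop_act P D"
  by (simp add: dop_act_def pm_deriv_funpow_const_mult matrix_mult_sum_left matrix_mul_assoc)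

lemma dop_act_zero [simp]: "dop_act 0 D = 0"
  by (simp add: dop_act_def)

lemma fop_act_upto:
  assumes "degree D \<le> m"
  shows "fop_act Q D x = (\<Sum>i\<le>m. nderiv i Q x ** coeff D i x)"
  unfolding fop_act_def using assms
  by (intro sum.mono_neutral_left) (auto simp: coeff_eq_0)

text \<open>The action at \<open>x\<close> involves the coefficients at \<open>x\<close> alone, so a
  factorization known only on a set can be used pointwise.\<close>

lemma fop_act_cong:
  assumes "\<And>i. coeff C i x = coeff D i x"
  shows "fop_act Q C x = fop_act Q D x"
  using fop_act_upto[of C "max (degree C) (degree D)" Q x]
    fop_act_upto[of D "max (degree C) (degree D)" Q x] assms by simp

lemma fop_act_zero: "fop_act Q 0 x = 0"
  by (simp add: fop_act_def)

lemma fop_act_add: "fop_act Q (C + D) x = fop_act Q C x + fop_act Q D x"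
proof -
  define m where "m = max (degree C) (degree D)"
  have "degree (C + D) \<le> m" unfolding m_def by (rule degree_add_le_max)
  then show ?thesis
    using fop_act_upto[of "C + D" m Q x] fop_act_upto[of C m Q x] fop_act_upto[of D m Q x]
    by (simp add: m_def matrix_add_ldistrib sum.distrib)
qed

lemma fop_act_sum: "fop_act Q (\<Sum>i\<in>I. D i) x = (\<Sum>i\<in>I. fop_act Q (D i) x)"
  by (induction I rule: infinite_finite_induct) (auto simp: fop_act_add fop_act_zero)

lemma fop_act_monom: "fop_act Q (monom F i) x = nderiv i Q x ** F x"
  by (subst fop_act_upto[OF degree_monom_le])
     (auto simp: if_distrib if_distribR sum.delta cong: if_cong)

lemma coeff_fop_of_dop: "coeff (fop_of_dop D) i = pm_eval (coeff D i)"
  by (simp add: fop_of_dop_def coeff_map_poly pm_eval_zero)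

lemma degree_fop_of_dop: "degree (fop_of_dop D) \<le> degree D"
  by (rule degree_le) (simp add: coeff_fop_of_dop coeff_eq_0 pm_eval_zero)

lemma fop_act_fop_of_dop: "fop_act (pm_eval P) (fop_of_dop D) x = pm_eval (dop_act P D) x"
  by (subst fop_act_upto[OF degree_fop_of_dop])
     (simp add: dop_act_def pm_eval_sum pm_eval_mult nderiv_pm_eval coeff_fop_of_dop)

text \<open>By the Leibniz rule \<open>fop_mult\<close> is composition. Only the coefficients of the
  left factor are differentiated, and these are polynomials; those of \<open>N\<close> may be
  arbitrary functions.\<close>

lemma fop_act_fop_mult:
  "fop_act (pm_eval P) (fop_mult (fop_of_dop V) N) x = fop_act (pm_eval (dop_act P V)) N x"
proof -
  define f where "f i j k = real (j choose k) *\<^sub>R (pm_eval ((pm_deriv ^^ k) ((pm_deriv ^^ i) P)) x **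
     pm_eval ((pm_deriv ^^ (j - k)) (coeff V i)) x) ** coeff N j x" for i j k
  have funpow: "(pm_deriv ^^ (i + k)) P = (pm_deriv ^^ k) ((pm_deriv ^^ i) P)" for i k
    by (simp add: add.commute[of i] funpow_add)
  \<comment> \<open>\<open>fop_mult\<close> sums up to this degree and \<open>dop_act\<close> up to
    \<open>degree V\<close>; the coefficients in between vanish.\<close>
  define d where "d = degree (fop_of_dop V)"
  have V: "dop_act P V = (\<Sum>i\<le>d. (pm_deriv ^^ i) P ** coeff V i)"
  proof -
    have "coeff V i = 0" if "i > d" for i
    proof -
      have "pm_eval (coeff V i) = pm_eval 0"
        using that coeff_eq_0[of "fop_of_dop V" i] by (simp add: d_def coeff_fop_of_dop pm_eval_zero)
      then show ?thesis
        by (intro pm_eval_eqI[of UNIV]) (auto simp: infinite_UNIV_char_0)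
    qed
    then show ?thesis
      unfolding dop_act_def using degree_fop_of_dop[of V]
      by (intro sum.mono_neutral_right) (auto simp: d_def)
  qed
  have "fop_act (pm_eval P) (fop_mult (fop_of_dop V) N) x =
      (\<Sum>i\<le>d. \<Sum>j\<le>degree N. \<Sum>k\<le>j. f i j k)"
    by (simp add: fop_mult_def fop_act_sum fop_act_monom nderiv_pm_eval coeff_fop_of_dop
        f_def matrix_mult_scaleR_left matrix_mult_scaleR_right matrix_mul_assoc d_def
        funpow)
  also have "\<dots> = (\<Sum>j\<le>degree N. \<Sum>i\<le>d. \<Sum>k\<le>j. f i j k)"
    by (rule sum.swap)
  also have "\<dots> = fop_act (pm_eval (dop_act P V)) N x"
    by (simp add: fop_act_def nderiv_pm_eval V pm_deriv_funpow_sum pm_eval_sum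
        pm_deriv_funpow_mult matrix_mult_sum_right f_def)
  finally show ?thesis .
qed

section \<open>Recovering coefficients from the action on polynomials\<close>

lemma fop_act_dpow:
  "fop_act (pm_eval (pm_dpow k)) N x =
     (\<Sum>i<k. pm_eval (pm_dpow (k - i)) x ** coeff N i x) + coeff N k x"
proof -
  have "fop_act (pm_eval (pm_dpow k)) N x =
      (\<Sum>i\<le>max k (degree N). if i \<le> k then pm_eval (pm_dpow (k - i)) x ** coeff N i x else 0)"
    by (subst fop_act_upto[of N "max k (degree N)"])
       (auto simp: nderiv_pm_eval pm_deriv_funpow_dpow pm_eval_zero intro!: sum.cong)
  also have "\<dots> = (\<Sum>i\<le>k. pm_eval (pm_dpow (k - i)) x ** coeff N i x)"
    by (intro sum.mono_neutral_cong_right) auto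
  finally show ?thesis
    by (simp add: pm_dpow_0 flip: lessThan_Suc_atMost)
qed

text \<open>The triangular equations on divided powers determine the coefficients one after
  another.\<close>

lemma fop_eqI:
  assumes "\<And>P x. fop_act (pm_eval P) C x = fop_act (pm_eval P) D x"
  shows "C = D"
proof (rule poly_eqI)
  fix k show "coeff C k = coeff D k"
  proof (induction k rule: less_induct)
    case (less k)
    show ?case
    proof
      fix x show "coeff C k x = coeff D k x"
        using assms[of "pm_dpow k" x] less by (simp add: fop_act_dpow)
    qed
  qed
qed

text \<open>The unit diagonal lets the triangular system be solved without division, so each
  coefficient is a polynomial on \<open>S\<close> once the earlier ones are.\<close>

lemma fop_polynomial_on:
  assumes "\<And>P. \<exists>R. \<forall>x\<in>S. fop_act (pm_eval P) N x = pm_eval R x"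
  shows "\<exists>M. \<forall>i. \<forall>x\<in>S. coeff N i x = pm_eval (coeff M i) x"
proof -
  have "\<exists>G. \<forall>x\<in>S. coeff N k x = pm_eval G x" for k
  proof (induction k rule: less_induct)
    case (less k)
    then have "\<forall>i. \<exists>G. i < k \<longrightarrow> (\<forall>x\<in>S. coeff N i x = pm_eval G x)" by blast
    then obtain G where G: "\<And>i x. i < k \<Longrightarrow> x \<in> S \<Longrightarrow> coeff N i x = pm_eval (G i) x"
      by metis
    obtain R where R: "\<And>x. x \<in> S \<Longrightarrow> fop_act (pm_eval (pm_dpow k)) N x = pm_eval R x"
      using assms by blast
    have "coeff N k x = pm_eval (R - (\<Sum>i<k. pm_dpow (k - i) ** G i)) x" if "x \<in> S" for x
      using R[OF that] G that
      by (simp add: fop_act_dpow pm_eval_diff pm_eval_sum pm_eval_mult algebra_simps)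
    then show ?case by blast
  qed
  then obtain G where G: "\<And>k x. x \<in> S \<Longrightarrow> coeff N k x = pm_eval (G k) x"
    by metis
  \<comment> \<open>The choice yields a \<open>G k\<close> for every \<open>k\<close>; cutting off
    at \<open>degree N\<close> gives an operator of finite order and drops only coefficients that
    are zero in \<open>N\<close>.\<close>
  define M where "M = (\<Sum>i\<le>degree N. monom (G i) i)"
  have M: "coeff M i = (if i \<le> degree N then G i else 0)" for i
    by (simp add: M_def coeff_sum)
  have "coeff N i x = pm_eval (coeff M i) x" if "x \<in> S" for i x
    using G[OF that, of i] M[of i] by (cases "i \<le> degree N") (simp_all add: coeff_eq_0 pm_eval_zero)
  then show ?thesis by blast
qed

section \<open>Degree-preserving operators\<close>

lemma degree_preserving_iff:
  "degree_preserving V \<longleftrightarrow> (\<forall>n P. pm_deg_less n (dop_act P V) \<longleftrightarrow> pm_deg_less n P)"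
proof
  assume "degree_preserving V"
  then show "\<forall>n P. pm_deg_less n (dop_act P V) \<longleftrightarrow> pm_deg_less n P"
    by (simp add: degree_preserving_def flip: pm_degree_less_iff)
next
  assume "\<forall>n P. pm_deg_less n (dop_act P V) \<longleftrightarrow> pm_deg_less n P"
  then show "degree_preserving V"
    unfolding degree_preserving_def by (intro allI pm_degree_eqI) blast
qed

text \<open>The leading coefficient of the image of \<open>pm_monom n\<close> is invertible: if
  \<open>M\<close> annihilates it from the left, the image of \<open>M\<close> times the monomial
  drops in degree, which forces \<open>M = 0\<close>. Leading terms can then be removed by
  induction.\<close>

lemma degree_preserving_surj:
  fixes V :: "'n::finite dop"
  assumes "degree_preserving V"
  shows "\<exists>P. dop_act P V = Q"
proof -
  have V: "pm_deg_less n (dop_act P V) \<longleftrightarrow> pm_deg_less n P" for n P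
    using assms by (simp add: degree_preserving_iff)
  have "\<exists>P. dop_act P V = Q" if "pm_deg_less n Q" for n and Q :: "'n pmat"
    using that
  proof (induction n arbitrary: Q)
    case 0
    then show ?case by (auto intro: exI[of _ 0])
  next
    case (Suc n)
    define E where "E = dop_act (pm_monom n) V"
    have E: "pm_deg_less (Suc n) E"
      by (simp add: E_def V pm_deg_less_monom)
    have "invertible (pm_coeff E n)"
    proof (rule invertible_if_left_cancel)
      fix M :: "'n cmat" assume M: "M ** pm_coeff E n = 0"
      have "pm_deg_less n (pm_const M ** E)"
        using E M by (intro pm_deg_less_SucI[OF pm_deg_less_const_mult]) (simp_all add: pm_coeff_const_mult)
      then have "pm_deg_less n (pm_const M ** pm_monom n)"
        by (simp add: E_def V flip: dop_act_const_mult)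
      then have "pm_coeff (pm_const M ** pm_monom n) n = 0"
        by (simp add: pm_deg_less_def)
      then show "M = 0" by (simp add: pm_coeff_const_mult pm_coeff_monom)
    qed
    then obtain B where B: "B ** pm_coeff E n = mat 1"
      using invertible_left_inverse by blast
    \<comment> \<open>With this factor \<open>pm_const C ** E\<close> has the same coefficient at
      \<open>n\<close> as \<open>Q\<close>.\<close>
    define C where "C = pm_coeff Q n ** B"
    have "pm_deg_less n (Q - pm_const C ** E)"
    proof (rule pm_deg_less_SucI)
      show "pm_deg_less (Suc n) (Q - pm_const C ** E)"
        using Suc.prems E by (intro pm_deg_less_diff pm_deg_less_const_mult)
      show "pm_coeff (Q - pm_const C ** E) n = 0"
        using B by (simp add: pm_coeff_diff pm_coeff_const_mult C_def flip: matrix_mul_assoc)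
    qed
    then obtain P where "dop_act P V = Q - pm_const C ** E"
      using Suc.IH by blast
    then have "dop_act (P + pm_const C ** pm_monom n) V = Q"
      by (simp add: dop_act_add dop_act_const_mult E_def)
    then show ?case by blast
  qed
  then show ?thesis using pm_deg_less_exists by blast
qed

section \<open>The inner product of a weight\<close>

lemma set_integral_bounded_linear:
  fixes f :: "'a \<Rightarrow> 'b::{banach, second_countable_topology}"
    and T :: "'b \<Rightarrow> 'c::{banach, second_countable_topology}"
  assumes "bounded_linear T" "set_integrable M S f"
  shows "set_integrable M S (\<lambda>x. T (f x))"
    and "(LINT x:S|M. T (f x)) = T (LINT x:S|M. f x)"
proof -
  have *: "(\<lambda>x. indicator S x *\<^sub>R T (f x)) = (\<lambda>x. T (indicator S x *\<^sub>R f x))"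
    using assms(1) by (simp add: linear_simps)
  show "set_integrable M S (\<lambda>x. T (f x))"
    using assms unfolding set_integrable_def * by (rule integrable_bounded_linear)
  show "(LINT x:S|M. T (f x)) = T (LINT x:S|M. f x)"
    using assms unfolding set_integrable_def set_lebesgue_integral_def *
    by (rule integral_bounded_linear)
qed

lemma set_integrable_finite_sum:
  fixes f :: "'i \<Rightarrow> 'a \<Rightarrow> 'b::{banach, second_countable_topology}"
  assumes "\<And>i. i \<in> I \<Longrightarrow> set_integrable M S (f i)"
  shows "set_integrable M S (\<lambda>x. \<Sum>i\<in>I. f i x)"
  using assms unfolding set_integrable_def scaleR_sum_right
  by (rule Bochner_Integration.integrable_sum)

lemma bounded_linear_matrix_mult_left:
  "bounded_linear (\<lambda>X. A ** X :: complex^'n::finite^'m::finite)"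
  by (intro linear_conv_bounded_linear[THEN iffD1] linearI)
     (simp_all add: matrix_add_ldistrib matrix_mult_scaleR_left)

lemma bounded_linear_matrix_mult_right:
  "bounded_linear (\<lambda>X. X ** A :: complex^'n::finite^'m::finite)"
  by (intro linear_conv_bounded_linear[THEN iffD1] linearI)
     (simp_all add: matrix_mult_add_right matrix_mult_scaleR_right)

lemma bounded_linear_hconj: "bounded_linear hconj"
  by (intro linear_conv_bounded_linear[THEN iffD1] linearI)
     (simp_all add: hconj_def vec_eq_iff)

lemma bounded_linear_matrix_entry:
  "bounded_linear (\<lambda>X::complex^'n::finite^'m::finite. X $ i $ j)"
  by (intro linear_conv_bounded_linear[THEN iffD1] linearI) simp_all

lemma set_integrable_matrixI:
  fixes F :: "'a \<Rightarrow> complex^'n::finite^'m::finite"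
  assumes "\<And>i j. set_integrable M S (\<lambda>x. F x $ i $ j)"
  shows "set_integrable M S F"
proof -
  have "set_integrable M S (\<lambda>x. \<Sum>i\<in>UNIV. \<Sum>j\<in>UNIV. axis i (axis j (F x $ i $ j)))"
    by (intro set_integrable_finite_sum set_integral_bounded_linear(1)[OF bounded_linear_matrix_unit] assms)
  then show ?thesis by (simp add: matrix_unit_sum)
qed

lemma set_integrable_poly_mult:
  fixes f :: "real \<Rightarrow> complex"
  assumes "\<And>m. set_integrable M S (\<lambda>x. complex_of_real x ^ m * f x)"
  shows "set_integrable M S (\<lambda>x. poly p (complex_of_real x) * f x)"
proof -
  have "set_integrable M S (\<lambda>x. \<Sum>i\<le>degree p. coeff p i * (complex_of_real x ^ i * f x))"
    by (intro set_integrable_finite_sum set_integrable_mult_right assms)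
  then show ?thesis
    by (simp add: poly_altdef sum_distrib_right mult.assoc)
qed

text \<open>If the set were finite, the nonempty open interval would be a union of two null
  sets.\<close>

lemma AE_einterval_infinite:
  assumes "a < b" "AE x in lebesgue. x \<in> einterval a b \<longrightarrow> \<phi> x"
  shows "infinite {x \<in> einterval a b. \<phi> x}"
proof
  assume "finite {x \<in> einterval a b. \<phi> x}"
  then have "negligible {x \<in> einterval a b. \<phi> x}" by (rule negligible_finite)
  moreover have "negligible {x \<in> einterval a b. \<not> \<phi> x}"
    using assms(2) by (simp add: completion.AE_iff_null_sets negligible_iff_null_sets)
  ultimately have "negligible ({x \<in> einterval a b. \<phi> x} \<union> {x \<in> einterval a b. \<not> \<phi> x})"
    by (rule negligible_Un)
  moreover have "{x \<in> einterval a b. \<phi> x} \<union> {x \<in> einterval a b. \<not> \<phi> x} = einterval a b"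
    by blast
  ultimately show False
    using open_not_negligible[OF open_einterval, of a b] einterval_nonempty[OF assms(1)] by auto
qed

locale weight =
  fixes a b :: ereal and W :: "real \<Rightarrow> complex ^ 'n::finite ^ 'n"
  assumes weight: "weight_matrix a b W"
begin

abbreviation ip :: "'n pmat \<Rightarrow> 'n pmat \<Rightarrow> 'n cmat" where
  "ip P Q \<equiv> inner_W a b W (pm_eval P) (pm_eval Q)"

lemma AE_pos_def: "AE x in lebesgue. x \<in> einterval a b \<longrightarrow> pos_def (W x)"
  using weight by (simp add: weight_matrix_def)

lemma infinite_AE:
  "AE x in lebesgue. x \<in> einterval a b \<longrightarrow> \<phi> x \<Longrightarrow> infinite {x \<in> einterval a b. \<phi> x}"
  using weight by (intro AE_einterval_infinite) (simp_all add: weight_matrix_def)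

lemma AE_invertible: "AE x in lebesgue. x \<in> einterval a b \<longrightarrow> invertible (W x)"
  using AE_pos_def by eventually_elim (simp add: pos_def_invertible)

text \<open>Each entry is a finite sum of polynomials times entries of \<open>W\<close>, since at
  real points the conjugate of a polynomial is the polynomial with conjugate coefficients. The
  moments then suffice.\<close>

lemma integrable_ip:
  "set_integrable lebesgue (einterval a b) (\<lambda>x. pm_eval P x ** W x ** hconj (pm_eval Q x))"
proof (rule set_integrable_matrixI)
  fix i j
  have "set_integrable lebesgue (einterval a b) (\<lambda>x. x ^ m *\<^sub>R W x)" for m
    using weight by (simp add: weight_matrix_def finite_moments_def)
  from set_integral_bounded_linear(1)[OF bounded_linear_matrix_entry this]
  have "set_integrable lebesgue (einterval a b) (\<lambda>x. complex_of_real x ^ m * W x $ l $ k)"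
    for m l k
    by (simp add: scaleR_conv_of_real[where 'a = complex])
  then have "set_integrable lebesgue (einterval a b) (\<lambda>x. \<Sum>k\<in>UNIV. \<Sum>l\<in>UNIV.
      poly (P $ i $ l * map_poly cnj (Q $ j $ k)) (complex_of_real x) * W x $ l $ k)"
    by (intro set_integrable_finite_sum set_integrable_poly_mult)
  then show "set_integrable lebesgue (einterval a b)
      (\<lambda>x. (pm_eval P x ** W x ** hconj (pm_eval Q x)) $ i $ j)"
    by (simp add: matrix_mult_component pm_eval_def hconj_def sum_distrib_right sum_distrib_left mult_ac)
qed

lemma ip_add_left: "ip (P + P') Q = ip P Q + ip P' Q"
  by (simp add: inner_W_def pm_eval_add matrix_mult_add_right set_integral_add(2)[OF integrable_ip integrable_ip])

lemma ip_add_right: "ip P (Q + Q') = ip P Q + ip P Q'"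
  by (simp add: inner_W_def pm_eval_add hconj_add matrix_add_ldistrib
      set_integral_add(2)[OF integrable_ip integrable_ip])

lemma ip_const_left: "ip (pm_const A ** P) Q = A ** ip P Q"
  using set_integral_bounded_linear(2)[OF bounded_linear_matrix_mult_left[of A] integrable_ip[of P Q]]
  by (simp add: inner_W_def pm_eval_mult matrix_mul_assoc)

lemma ip_const_right: "ip P (pm_const A ** Q) = ip P Q ** hconj A"
  using set_integral_bounded_linear(2)[OF bounded_linear_matrix_mult_right[of "hconj A"] integrable_ip[of P Q]]
  by (simp add: inner_W_def pm_eval_mult hconj_mult matrix_mul_assoc)

lemma ip_zero_right [simp]: "ip P 0 = 0"
  using ip_const_right[of P 0 0] by simp

lemma ip_diff_left: "ip (P - P') Q = ip P Q - ip P' Q"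
  using ip_add_left[of "P - P'" P' Q] by (simp add: algebra_simps)

text \<open>\<open>W\<close> is invertible almost everywhere, so values of \<open>F\<close>
  elsewhere do not affect the integral. Measurability of the integrand follows from completeness of
  Lebesgue measure.\<close>

lemma inner_AE_polynomial:
  assumes "\<And>x. x \<in> einterval a b \<Longrightarrow> invertible (W x) \<Longrightarrow> F x = pm_eval Q x"
  shows "inner_W a b W (pm_eval P) F = ip P Q"
proof -
  let ?f = "\<lambda>x. indicator (einterval a b) x *\<^sub>R (pm_eval P x ** W x ** hconj (pm_eval Q x))"
  let ?g = "\<lambda>x. indicator (einterval a b) x *\<^sub>R (pm_eval P x ** W x ** hconj (F x))"
  have f: "?f \<in> borel_measurable lebesgue"
    using integrable_ip[of P Q] unfolding set_integrable_def by (rule borel_measurable_integrable)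
  have ae: "AE x in lebesgue. ?f x = ?g x"
    using AE_invertible by eventually_elim (use assms in \<open>auto simp: indicator_def\<close>)
  then have "?g \<in> borel_measurable lebesgue"
    by (rule borel_measurable_AE[OF f])
  from integral_cong_AE[OF f this ae] show ?thesis
    unfolding inner_W_def set_lebesgue_integral_def by simp
qed

lemma hconj_ip: "hconj (ip P Q) = ip Q P"
proof -
  have "hconj (ip P Q) =
      (LINT x:einterval a b|lebesgue. hconj (pm_eval P x ** W x ** hconj (pm_eval Q x)))"
    unfolding inner_W_def
    by (rule set_integral_bounded_linear(2)[OF bounded_linear_hconj integrable_ip, symmetric])
  also have "\<dots> = ip Q P"
    unfolding inner_W_def set_lebesgue_integral_def
  proof (rule integral_cong_AE)
    show "AE x in lebesgue. indicator (einterval a b) x *\<^sub>R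
        hconj (pm_eval P x ** W x ** hconj (pm_eval Q x)) =
        indicator (einterval a b) x *\<^sub>R (pm_eval Q x ** W x ** hconj (pm_eval P x))"
      using AE_pos_def
      by eventually_elim (auto simp: hconj_mult pos_def_def matrix_mul_assoc indicator_def)
  qed (use integrable_ip[of Q P]
        set_integral_bounded_linear(1)[OF bounded_linear_hconj integrable_ip, of P Q]
      in \<open>auto simp: set_integrable_def dest: borel_measurable_integrable\<close>)
  finally show ?thesis .
qed

text \<open>The diagonal entry \<open>i\<close> of the integrand is the quadratic form of
  \<open>W x\<close> at the conjugated row \<open>i\<close> of \<open>P\<close>. It is nonnegative
  almost everywhere with integral zero, so positive definiteness makes the row vanish almost
  everywhere.\<close>

lemma ip_self_zero:
  assumes "ip P P = 0"
  shows "P = 0"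
proof -
  let ?I = "einterval a b"
  have "AE x in lebesgue. x \<in> ?I \<longrightarrow> pm_eval P x $ i = 0" for i
  proof -
    define f where "f x = Re ((pm_eval P x ** W x ** hconj (pm_eval P x)) $ i $ i)" for x
    have quad: "f x = Re (\<Sum>l\<in>UNIV. cnj (v $ l) * (W x *v v) $ l)"
      if "v = (\<chi> k. cnj (pm_eval P x $ i $ k))" for x v
    proof -
      have "(pm_eval P x ** W x ** hconj (pm_eval P x)) $ i $ i =
          (\<Sum>l\<in>UNIV. cnj (v $ l) * (W x *v v) $ l)"
        by (subst matrix_mul_assoc[symmetric])
           (simp add: that matrix_mult_component hconj_def matrix_vector_mult_def)
      then show ?thesis by (simp add: f_def)
    qed
    have T: "bounded_linear (\<lambda>X :: 'n cmat. Re (X $ i $ i))"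
      by (rule bounded_linear_compose[OF bounded_linear_Re bounded_linear_matrix_entry])
    have int: "integrable lebesgue (\<lambda>x. indicator ?I x *\<^sub>R f x)"
      using set_integral_bounded_linear(1)[OF T integrable_ip, of P P]
      by (simp add: set_integrable_def f_def)
    have "integral\<^sup>L lebesgue (\<lambda>x. indicator ?I x *\<^sub>R f x) = 0"
      using set_integral_bounded_linear(2)[OF T integrable_ip, of P P] assms
      by (simp add: set_lebesgue_integral_def inner_W_def f_def)
    moreover have pos: "AE x in lebesgue. 0 \<le> indicator ?I x *\<^sub>R f x"
      using AE_pos_def
    proof eventually_elim
      case (elim x)
      define v where "v = (\<chi> k. cnj (pm_eval P x $ i $ k))"
      show ?case
        using elim quad[OF v_def] by (cases "v = 0") (auto simp: pos_def_def indicator_def less_imp_le)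
    qed
    ultimately have "AE x in lebesgue. indicator ?I x *\<^sub>R f x = 0"
      using integral_nonneg_eq_0_iff_AE[OF int pos] by simp
    with AE_pos_def show ?thesis
    proof eventually_elim
      case (elim x)
      define v where "v = (\<chi> k. cnj (pm_eval P x $ i $ k))"
      have "x \<in> ?I \<longrightarrow> v = 0"
        using elim quad[OF v_def] by (cases "v = 0") (auto simp: pos_def_def indicator_def)
      then show ?case by (simp add: v_def vec_eq_iff)
    qed
  qed
  then have "AE x in lebesgue. \<forall>i\<in>UNIV. x \<in> ?I \<longrightarrow> pm_eval P x $ i = 0"
    by (intro AE_finite_allI) auto
  then have "AE x in lebesgue. x \<in> ?I \<longrightarrow> pm_eval P x = 0"
    by eventually_elim (simp add: vec_eq_iff)
  then show ?thesis
    by (intro pm_eval_eqI[OF infinite_AE]) (auto simp: pm_eval_zero)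
qed

section \<open>Orthogonal polynomials\<close>

text \<open>Orthogonality to everything of lower degree describes each polynomial separately,
  without the rest of the sequence.\<close>

definition monic_orth :: "nat \<Rightarrow> 'n pmat \<Rightarrow> bool" where
  "monic_orth n p \<longleftrightarrow> pm_deg_less (Suc n) p \<and> pm_coeff p n = mat 1 \<and>
     (\<forall>Q. pm_deg_less n Q \<longrightarrow> ip p Q = 0)"

lemma monic_split:
  assumes "pm_deg_less (Suc n) p" "pm_coeff p n = mat 1" "pm_deg_less (Suc n) Q"
  shows "pm_deg_less n (Q - pm_const (pm_coeff Q n) ** p)"
  by (rule pm_deg_less_SucI)
     (use assms in \<open>auto simp: pm_coeff_diff pm_coeff_const_mult
        intro!: pm_deg_less_diff pm_deg_less_const_mult\<close>)

text \<open>If \<open>M\<close> annihilates the Gram matrix, then \<open>M\<close> times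
  \<open>p\<close> has norm zero, hence vanishes, and its leading coefficient is \<open>M\<close>.
  This replaces the nonzero norm of scalar Gram-Schmidt.\<close>

lemma monic_invertible:
  assumes "pm_coeff p n = mat 1"
  shows "invertible (ip p p)"
proof (rule invertible_if_left_cancel)
  fix M :: "'n cmat" assume "M ** ip p p = 0"
  then have "ip (pm_const M ** p) (pm_const M ** p) = 0"
    by (simp add: ip_const_left ip_const_right matrix_mul_assoc)
  then have "pm_const M ** p = 0" by (rule ip_self_zero)
  then have "pm_coeff (pm_const M ** p) n = 0" by simp
  then show "M = 0"
    using assms by (simp add: pm_coeff_const_mult)
qed

text \<open>Gram-Schmidt with left matrix coefficients. \<open>R\<close> is arbitrary in the
  induction because the hypothesis is used twice: on \<open>pm_monom n\<close>, to build the next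
  monic polynomial \<open>p\<close>, and on \<open>R\<close> itself.\<close>

lemma orthogonal_projection:
  "\<exists>L. pm_deg_less n L \<and> (\<forall>Q. pm_deg_less n Q \<longrightarrow> ip (R - L) Q = 0)"
proof (induction n arbitrary: R)
  case 0
  then show ?case by (auto intro: exI[of _ 0])
next
  case (Suc n)
  obtain L0 where L0: "pm_deg_less n L0" "\<And>Q. pm_deg_less n Q \<Longrightarrow> ip (pm_monom n - L0) Q = 0"
    using Suc by blast
  define p where "p = pm_monom n - L0"
  have p: "pm_deg_less (Suc n) p" "pm_coeff p n = mat 1" "\<And>Q. pm_deg_less n Q \<Longrightarrow> ip p Q = 0"
    using L0 by (auto simp: p_def pm_coeff_diff pm_coeff_monom pm_deg_less_def)
  obtain G where G: "G ** ip p p = mat 1"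
    using monic_invertible[OF p(2)] invertible_left_inverse by blast
  obtain L1 where L1: "pm_deg_less n L1" "\<And>Q. pm_deg_less n Q \<Longrightarrow> ip (R - L1) Q = 0"
    using Suc by blast
  \<comment> \<open>The Fourier coefficient along \<open>p\<close>: it satisfies
    \<open>C ** ip p p = ip (R - L1) p\<close>.\<close>
  define C where "C = ip (R - L1) p ** G"
  define L where "L = L1 + pm_const C ** p"
  have RL: "R - L = (R - L1) - pm_const C ** p"
    by (simp add: L_def)
  have "pm_deg_less (Suc n) L"
    unfolding L_def by (intro pm_deg_less_add pm_deg_less_const_mult p pm_deg_less_mono[OF L1(1)]) simp
  moreover have "ip (R - L) Q = 0" if Q: "pm_deg_less (Suc n) Q" for Q
  proof -
    have 1: "ip (R - L) Q' = 0" if "pm_deg_less n Q'" for Q'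
      unfolding RL using L1(2)[OF that] p(3)[OF that] by (simp add: ip_diff_left ip_const_left)
    have 2: "ip (R - L) p = 0"
      unfolding RL ip_diff_left ip_const_left
      by (simp add: ip_diff_left[symmetric] C_def G flip: matrix_mul_assoc)
    have "ip (R - L) Q = ip (R - L) ((Q - pm_const (pm_coeff Q n) ** p) + pm_const (pm_coeff Q n) ** p)"
      by simp
    also have "\<dots> = 0"
      unfolding ip_add_right ip_const_right 2 using 1[OF monic_split[OF p(1,2) Q]] by simp
    finally show ?thesis .
  qed
  ultimately show ?case by blast
qed

text \<open>The difference has degree below \<open>n\<close> and is orthogonal to all such
  polynomials, itself included. As \<open>Q\<close> need not be monic, this gives both uniqueness of
  \<open>p\<close> and the matrices \<open>A\<close> of the Darboux transformation.\<close>

lemma monic_orth_unique: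
  assumes "monic_orth n p" "pm_deg_less (Suc n) Q"
    and "\<And>R. pm_deg_less n R \<Longrightarrow> ip Q R = 0"
  shows "Q = pm_const (pm_coeff Q n) ** p"
proof -
  let ?D = "Q - pm_const (pm_coeff Q n) ** p"
  have D: "pm_deg_less n ?D"
    using assms by (intro monic_split) (auto simp: monic_orth_def)
  have "ip ?D ?D = 0"
    using assms(1) assms(3)[OF D] D
    by (subst ip_diff_left) (simp add: ip_const_left monic_orth_def)
  then show ?thesis
    using ip_self_zero by fastforce
qed

lemma monic_orthogonal_iff: "monic_orthogonal a b W P \<longleftrightarrow> (\<forall>n. monic_orth n (P n))"
proof
  assume P: "\<forall>n. monic_orth n (P n)"
  have *: "ip (P n) (P m) = 0" if "m < n" for n m
  proof -
    have "pm_deg_less n (P m)"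
      using P that by (auto simp: monic_orth_def intro!: pm_deg_less_mono[of "Suc m" "P m" n])
    then show ?thesis using P by (simp add: monic_orth_def)
  qed
  have "ip (P n) (P m) = 0" if "n \<noteq> m" for n m
    using that *[of m n] *[of n m] hconj_ip[of "P m" "P n"]
    by (cases "m < n") auto
  moreover have "\<not> pm_deg_less n (P n)" for n
    using P[rule_format, of n] by (auto simp: monic_orth_def pm_deg_less_def vec_eq_iff mat_def)
  ultimately show "monic_orthogonal a b W P"
    using P by (auto simp: monic_orthogonal_def pm_degree_eq_iff monic_orth_def)
next
  assume P: "monic_orthogonal a b W P"
  \<comment> \<open>Induction on the bound \<open>m\<close> with \<open>n\<close> fixed: each step
    splits off a multiple of some \<open>P m\<close> with \<open>m < n\<close>.\<close>
  have "ip (P n) Q = 0" if "pm_deg_less m Q" "m \<le> n" for m n Q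
    using that
  proof (induction m arbitrary: Q)
    case 0
    then show ?case by simp
  next
    case (Suc m)
    have "pm_deg_less m (Q - pm_const (pm_coeff Q m) ** P m)"
      using P Suc.prems by (intro monic_split) (auto simp: monic_orthogonal_def pm_degree_eq_iff)
    then have "ip (P n) (Q - pm_const (pm_coeff Q m) ** P m) = 0"
      using Suc by simp
    moreover have "ip (P n) (P m) = 0"
      using P Suc.prems by (simp add: monic_orthogonal_def)
    ultimately show ?case
      using ip_add_right[of "P n" "Q - pm_const (pm_coeff Q m) ** P m" "pm_const (pm_coeff Q m) ** P m"]
      by (simp add: ip_const_right)
  qed
  then show "\<forall>n. monic_orth n (P n)"
    using P by (auto simp: monic_orth_def monic_orthogonal_def pm_degree_eq_iff)
qed

lemma monic_orth_exists: "\<exists>p. monic_orth n p"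
proof -
  obtain L where L: "pm_deg_less n L" "\<And>Q. pm_deg_less n Q \<Longrightarrow> ip (pm_monom n - L) Q = 0"
    using orthogonal_projection by blast
  then have "monic_orth n (pm_monom n - L)"
    by (auto simp: monic_orth_def pm_coeff_diff pm_coeff_monom pm_deg_less_def)
  then show ?thesis ..
qed

text \<open>The definite description in \<open>monic_ops\<close> becomes usable once existence and
  uniqueness of the sequence are established.\<close>

lemma monic_orth_monic_ops: "monic_orth n (monic_ops a b W n)"
proof -
  obtain P where P: "\<And>n. monic_orth n (P n)"
    using monic_orth_exists by metis
  have "Q = P" if "monic_orthogonal a b W Q" for Q
  proof
    fix n
    have "monic_orth n (Q n)"
      using that by (simp add: monic_orthogonal_iff)
    then show "Q n = P n"
      using monic_orth_unique[OF P, of n "Q n"] pm_const_mat_1 by (simp add: monic_orth_def)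
  qed
  moreover have "monic_orthogonal a b W P"
    using P by (simp add: monic_orthogonal_iff)
  ultimately have "monic_orthogonal a b W (monic_ops a b W)"
    unfolding monic_ops_def by (intro theI[of "monic_orthogonal a b W" P])
  then show ?thesis by (simp add: monic_orthogonal_iff)
qed

section \<open>Operators with the orthogonal polynomials as eigenfunctions\<close>

text \<open>In the expansion of \<open>P\<close> along the orthogonal polynomials, \<open>D\<close>
  only inserts constant factors \<Lambda>, so no degree rises.\<close>

lemma D_algebra_deg_less:
  assumes D: "D \<in> D_algebra a b W" and "pm_deg_less n P"
  shows "pm_deg_less n (dop_act P D)"
  using assms(2)
proof (induction n arbitrary: P)
  case (Suc n)
  define p where "p = monic_ops a b W n"
  have p: "pm_deg_less (Suc n) p" "pm_coeff p n = mat 1"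
    using monic_orth_monic_ops[of n] by (auto simp: p_def monic_orth_def)
  define L where "L = P - pm_const (pm_coeff P n) ** p"
  have P: "P = pm_const (pm_coeff P n) ** p + L"
    by (simp add: L_def)
  obtain \<Lambda> where \<Lambda>: "dop_act p D = pm_const \<Lambda> ** p"
    using D by (auto simp: D_algebra_def p_def)
  have "pm_deg_less n L"
    unfolding L_def by (rule monic_split[OF p Suc.prems])
  then have "pm_deg_less (Suc n) (dop_act L D)"
    using Suc.IH pm_deg_less_mono by (metis le_Suc_eq order_refl)
  then have "pm_deg_less (Suc n) (dop_act (pm_const (pm_coeff P n) ** p + L) D)"
    by (simp add: dop_act_add dop_act_const_mult \<Lambda> pm_deg_less_add pm_deg_less_const_mult p)
  then show ?case
    using P by simp
qed simp

text \<open>If the degree dropped, the coefficient \<open>C\<close> of \<open>P\<close> at some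
  \<open>m \<ge> n\<close> would satisfy \<open>C ** \<Lambda> = 0\<close>. Then \<open>D\<close>
  annihilates \<open>C\<close> times the orthogonal polynomial of degree \<open>m\<close>, and
  injectivity gives \<open>C = 0\<close>. The bound \<open>m\<close> thus descends to
  \<open>n\<close>.\<close>

lemma D_algebra_injective_degree_preserving:
  assumes D: "D \<in> D_algebra a b W" and inj: "\<And>P. dop_act P D = 0 \<Longrightarrow> P = 0"
  shows "degree_preserving D"
proof -
  have *: "pm_deg_less n P" if "pm_deg_less n (dop_act P D)" "pm_deg_less m P" for n m P
    using that(2)
  proof (induction m)
    case (Suc m)
    show ?case
    proof (cases "n \<le> m")
      case False
      then show ?thesis
        using Suc.prems pm_deg_less_mono by (metis not_less_eq_eq)
    next
      case True
      define p where "p = monic_ops a b W m"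
      have p: "pm_deg_less (Suc m) p" "pm_coeff p m = mat 1"
        using monic_orth_monic_ops[of m] by (auto simp: p_def monic_orth_def)
      define C where "C = pm_coeff P m"
      define L where "L = P - pm_const C ** p"
      have P: "P = pm_const C ** p + L"
        by (simp add: L_def)
      obtain \<Lambda> where \<Lambda>: "dop_act p D = pm_const \<Lambda> ** p"
        using D by (auto simp: D_algebra_def p_def)
      have "pm_deg_less m L"
        unfolding L_def C_def by (rule monic_split[OF p Suc.prems])
      then have "pm_coeff (dop_act L D) m = 0"
        using D_algebra_deg_less[OF D] by (simp add: pm_deg_less_def)
      moreover have "pm_coeff (dop_act (pm_const C ** p + L) D) m = 0"
        using that(1) True P by (simp add: pm_deg_less_def)
      ultimately have "C ** \<Lambda> = 0"
        by (simp add: dop_act_add dop_act_const_mult \<Lambda> pm_coeff_add pm_coeff_const_mult p)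
      then have "dop_act (pm_const C ** p) D = 0"
        by (simp add: dop_act_const_mult \<Lambda> matrix_mul_assoc flip: pm_const_mult)
      then have "pm_const C ** p = 0" by (rule inj)
      then have "pm_coeff (pm_const C ** p) m = 0" by simp
      then have "C = 0"
        by (simp add: pm_coeff_const_mult p)
      then show ?thesis
        using Suc.IH pm_deg_less_SucI[OF Suc.prems] by (simp add: C_def)
    qed
  qed simp
  then show ?thesis
    unfolding degree_preserving_iff
    using pm_deg_less_exists D_algebra_deg_less[OF D] by blast
qed

end

section \<open>Construction of the Darboux factorization\<close>

theorem proposition3p4:
  fixes a b :: ereal
    and W W' :: "real \<Rightarrow> complex ^ 'n::finite ^ 'n"
    and V D :: "'n dop"
    and N :: "'n fop"
  assumes "weight_matrix a b W" and "weight_matrix a b W'"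
    and "degree_preserving V"
    and "N = conjugate_adjoint W W' V"
    and "D \<in> D_algebra a b W"
    and "fop_eq_on {x \<in> einterval a b. invertible (W x)} (fop_of_dop D) (fop_mult (fop_of_dop V) N)"
    and "\<forall>P Q. inner_W a b W' (pm_eval (dop_act P V)) (pm_eval Q)
             = inner_W a b W (pm_eval P) (fop_act (pm_eval Q) N)"
  shows "darboux_transformation a b W W'"
proof -
  interpret W: weight a b W by standard fact
  interpret W': weight a b W' by standard fact
  define S where "S = {x \<in> einterval a b. invertible (W x)}"
  have "infinite S"
    unfolding S_def by (rule W.infinite_AE[OF W.AE_invertible])
  have VN: "fop_act (pm_eval (dop_act P V)) N x = pm_eval (dop_act P D) x" if "x \<in> S" for P x
  proof -
    have "fop_act (pm_eval P) (fop_of_dop D) x = fop_act (pm_eval P) (fop_mult (fop_of_dop V) N) x"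
      using assms(6) that by (intro fop_act_cong) (simp add: fop_eq_on_def S_def)
    then show ?thesis
      by (simp add: fop_act_fop_of_dop fop_act_fop_mult)
  qed
  have surj: "\<exists>P. Q = dop_act P V" for Q
    using degree_preserving_surj[OF assms(3)] by metis
  have "\<exists>R. \<forall>x\<in>S. fop_act (pm_eval Q) N x = pm_eval R x" for Q
    using surj[of Q] VN by blast
  then obtain M where "\<forall>i. \<forall>x\<in>S. coeff N i x = pm_eval (coeff M i) x"
    using fop_polynomial_on by blast
  then have NM: "fop_act (pm_eval Q) N x = pm_eval (dop_act Q M) x" if "x \<in> S" for Q x
    using that fop_act_cong[of N x "fop_of_dop M"]
    by (simp add: coeff_fop_of_dop fop_act_fop_of_dop)
  \<comment> \<open>Both sides are polynomials that agree on the infinite set \<open>S\<close>,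
    hence everywhere.\<close>
  have VM: "dop_act (dop_act P V) M = dop_act P D" for P
    using VN NM by (intro pm_eval_eqI[OF \<open>infinite S\<close>]) metis
  have adj: "W'.ip (dop_act P V) Q = W.ip P (dop_act Q M)" for P Q
    using assms(7) NM W.inner_AE_polynomial[of "fop_act (pm_eval Q) N" "dop_act Q M" P]
    by (simp add: S_def)
  have V: "pm_deg_less n (dop_act P V) \<longleftrightarrow> pm_deg_less n P" for n P
    using assms(3) by (simp add: degree_preserving_iff)
  have "degree_preserving D"
  proof (rule W.D_algebra_injective_degree_preserving[OF assms(5)])
    fix P assume "dop_act P D = 0"
    then have "W'.ip (dop_act P V) (dop_act P V) = 0"
      by (simp add: adj VM)
    then have "pm_deg_less 0 (dop_act P V)"
      using W'.ip_self_zero by simp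
    then show "P = 0" by (simp only: V pm_deg_less_0_iff)
  qed
  \<comment> \<open>Writing \<open>Q\<close> as the image of \<open>P\<close> under
    \<open>V\<close>, the polynomials \<open>Q\<close>, \<open>P\<close> and the image of
    \<open>P\<close> under \<open>D\<close> have the same degree bounds.\<close>
  then have M: "pm_deg_less n (dop_act Q M) \<longleftrightarrow> pm_deg_less n Q" for n Q
    using surj[of Q] V VM by (metis degree_preserving_iff)
  \<comment> \<open>For \<open>R\<close> of degree below \<open>n\<close>, \<open>adj\<close> moves
    \<open>V\<close> across as \<open>M\<close>, and the image of \<open>R\<close> under
    \<open>M\<close> still has degree below \<open>n\<close>.\<close>
  have "dop_act (monic_ops a b W n) V =
      pm_const (pm_coeff (dop_act (monic_ops a b W n) V) n) ** monic_ops a b W' n" for n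
    using W.monic_orth_monic_ops[of n]
    by (intro W'.monic_orth_unique W'.monic_orth_monic_ops)
       (auto simp: V M adj W.monic_orth_def)
  moreover have "fop_of_dop D = fop_mult (fop_of_dop V) (fop_of_dop M)"
    by (rule fop_eqI) (simp add: fop_act_fop_of_dop fop_act_fop_mult VM)
  moreover have "degree_preserving M"
    by (simp add: degree_preserving_iff M)
  ultimately show ?thesis
    unfolding darboux_transformation_def using assms(1-3,5) by blast
qed

end
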